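(* Let $n\ge 4$ and let $S=\{x,y,z,w\}$ be a set of four distinct vertices of $D_n$ such that the vertices of $S$ lie in exactly three clusters of $D_n$. Then there exist $n-1$ internally disjoint $S$-trees in $D_n$.
   Context: The $n$-dimensional dual cube $D_n$ has vertex set all $(2n-1)$-bit binary strings $u_1u_2\cdots u_{2n-1}$. Two vertices $u,v$ are adjacent iff they differ in exactly one bit position $i$, and moreover: if $1\le i\le n-1$ then $u_{2n-1}=v_{2n-1}=0$; if $n\le i\le 2n-2$ then $u_{2n-1}=v_{2n-1}=1$; (if $i=2n-1$ there is no further condition). A cluster of class $0$ is a set of all vertices with last bit $0$ and a fixed value of the bits in positions $n,\dots,2n-2$; a cluster of class $1$ is a set of all vertices with last bit $1$ and a fixed value of the bits in positions $1,\dots,n-1$. The clusters partition $V(D_n)$. For $S\subseteq V(G)$, an $S$-tree is a subtree of $G$ whose vertex set contains $S$; a family of $S$-trees $T_1,\dots,T_m$ is internally disjoint if the trees are pairwise edge-disjoint and $V(T_i)\cap V(T_j)=S$ for all $i\ne j$. *)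

theory Defs
  imports Main
begin

text \<open>Vertices of the dual cube D_n: binary strings u_1 ... u_{2n-1}, represented as
  bool lists of length 2n-1; bit i (1-based) is u ! (i - 1).\<close>

type_synonym vertex = "bool list"

definition bit :: "vertex \<Rightarrow> nat \<Rightarrow> bool" where
  "bit u i = u ! (i - 1)"

definition dc_vertices :: "nat \<Rightarrow> vertex set" where
  "dc_vertices n = {u. length u = 2 * n - 1}"

definition dc_adj :: "nat \<Rightarrow> vertex \<Rightarrow> vertex \<Rightarrow> bool" where
  "dc_adj n u v \<longleftrightarrow> u \<in> dc_vertices n \<and> v \<in> dc_vertices n \<and>
     (\<exists>i\<in>{1..2*n-1}. bit u i \<noteq> bit v i \<and>
        (\<forall>j\<in>{1..2*n-1}. j \<noteq> i \<longrightarrow> bit u j = bit v j) \<and>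
        (1 \<le> i \<and> i \<le> n - 1 \<longrightarrow> \<not> bit u (2*n-1) \<and> \<not> bit v (2*n-1)) \<and>
        (n \<le> i \<and> i \<le> 2*n - 2 \<longrightarrow> bit u (2*n-1) \<and> bit v (2*n-1)))"

text \<open>Edges of D_n as unordered pairs.\<close>
definition dc_edges :: "nat \<Rightarrow> vertex set set" where
  "dc_edges n = {{u, v} | u v. dc_adj n u v}"

text \<open>Clusters of class 0 and class 1.\<close>
definition dc_clusters :: "nat \<Rightarrow> vertex set set" where
  "dc_clusters n =
     {{u \<in> dc_vertices n. \<not> bit u (2*n-1) \<and> (\<forall>i\<in>{n..2*n-2}. bit u i = bit u0 i)}
       | u0. u0 \<in> dc_vertices n \<and> \<not> bit u0 (2*n-1)} \<union>
     {{u \<in> dc_vertices n. bit u (2*n-1) \<and> (\<forall>i\<in>{1..n-1}. bit u i = bit u0 i)}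
       | u0. u0 \<in> dc_vertices n \<and> bit u0 (2*n-1)}"

text \<open>Graphs given by a vertex set and a set of (2-element) edges.\<close>
definition edge_rel :: "'a set set \<Rightarrow> ('a \<times> 'a) set" where
  "edge_rel E = {(a, b). {a, b} \<in> E \<and> a \<noteq> b}"

definition connected_graph :: "'a set \<Rightarrow> 'a set set \<Rightarrow> bool" where
  "connected_graph V E \<longleftrightarrow> (\<forall>a\<in>V. \<forall>b\<in>V. (a, b) \<in> (edge_rel E)\<^sup>*)"

text \<open>A cycle: distinct vertices v_0,...,v_k (k >= 2) with consecutive edges and the closing edge.\<close>
definition has_cycle :: "'a set set \<Rightarrow> bool" where
  "has_cycle E \<longleftrightarrow> (\<exists>vs. length vs \<ge> 3 \<and> distinct vs \<and>
      (\<forall>i < length vs - 1. {vs ! i, vs ! Suc i} \<in> E) \<and> {last vs, hd vs} \<in> E)"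

definition is_tree :: "'a set \<Rightarrow> 'a set set \<Rightarrow> bool" where
  "is_tree V E \<longleftrightarrow> V \<noteq> {} \<and> (\<forall>e\<in>E. e \<subseteq> V) \<and> connected_graph V E \<and> \<not> has_cycle E"

text \<open>A subtree of D_n.\<close>
definition dc_subtree :: "nat \<Rightarrow> vertex set \<Rightarrow> vertex set set \<Rightarrow> bool" where
  "dc_subtree n V E \<longleftrightarrow> V \<subseteq> dc_vertices n \<and> E \<subseteq> dc_edges n \<and> is_tree V E"

text \<open>An S-tree: a subtree whose vertex set contains S.\<close>
definition dc_S_tree :: "nat \<Rightarrow> vertex set \<Rightarrow> vertex set \<times> vertex set set \<Rightarrow> bool" where
  "dc_S_tree n S T \<longleftrightarrow> dc_subtree n (fst T) (snd T) \<and> S \<subseteq> fst T"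

text \<open>Internally disjoint family T_0, ..., T_{m-1}.\<close>
definition internally_disjoint ::
  "vertex set \<Rightarrow> nat \<Rightarrow> (nat \<Rightarrow> vertex set \<times> vertex set set) \<Rightarrow> bool" where
  "internally_disjoint S m T \<longleftrightarrow>
     (\<forall>i<m. \<forall>j<m. i \<noteq> j \<longrightarrow> snd (T i) \<inter> snd (T j) = {} \<and> fst (T i) \<inter> fst (T j) = S)"

end

theory Submission
  imports Defs
begin

text \<open>
  Put m = n - 1 and write a vertex as (a, b, t) with a and b in the m-cube Q. Clusters of class 0
  are the rows (b fixed, t = 0), clusters of class 1 the columns (a fixed, t = 1), and every row
  meets every column in exactly one edge (a, b, 0) - (a, b, 1). In Q, for any u and v, the m
  neighbours of u are joined to v by m connected sets that pairwise meet only in v (a fan).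

  Let x and y share the row b. The fan from the neighbours of x to y gives m disjoint x-y
  connections in that row; the i-th one leaves it at a contact a_i, which is the i-th neighbour of x,
  or x itself if that neighbour is y. The columns a_i are distinct, so the i-th tree may use all of
  column a_i. A terminal in another row is reached from the entry points a_i by a fan around the
  neighbours of x. A terminal in a column c is reached through m distinct rows, each owned by one
  tree; these rows are chosen either as a fan that avoids the rows of the terminals, or, if both
  remaining terminals lie in columns, as the neighbours of b, in which case a contact a_i = c does
  no harm because b can be added to the i-th set of the fan. Only the tree with x + e_i = y ever
  uses an edge between terminals, so it suffices to take spanning trees.
\<close>

section \<open>Connected sets and spanning trees\<close>

definition conn :: "('a \<Rightarrow> 'a \<Rightarrow> bool) \<Rightarrow> 'a set \<Rightarrow> bool" where
  "conn R W \<longleftrightarrow> (\<forall>p\<in>W. \<forall>q\<in>W. (p, q) \<in> {(a, b). a \<in> W \<and> b \<in> W \<and> R a b}\<^sup>*)"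

lemma conn_singleton [simp]: "conn R {p}"
  by (simp add: conn_def)

lemma conn_image:
  assumes "conn R W" and "\<And>p q. p \<in> W \<Longrightarrow> q \<in> W \<Longrightarrow> R p q \<Longrightarrow> R' (f p) (f q)"
  shows "conn R' (f ` W)"
proof -
  have "(f p, f q) \<in> {(a, b). a \<in> f ` W \<and> b \<in> f ` W \<and> R' a b}\<^sup>*"
    if "(p, q) \<in> {(a, b). a \<in> W \<and> b \<in> W \<and> R a b}\<^sup>*" for p q
    using that
  proof (induction rule: rtrancl_induct)
    case (step q r)
    then have "(f q, f r) \<in> {(a, b). a \<in> f ` W \<and> b \<in> f ` W \<and> R' a b}"
      using assms(2) by auto
    with step.IH show ?case by (rule rtrancl_into_rtrancl)
  qed simp
  then show ?thesis using assms(1) by (auto simp: conn_def)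
qed

lemma conn_Un_edge:
  assumes A: "conn R A" and B: "conn R B" and p: "p \<in> A" and q: "q \<in> B"
    and pq: "R p q" and sym: "symp R"
  shows "conn R (A \<union> B)"
proof -
  let ?E = "\<lambda>W. {(a, b). a \<in> W \<and> b \<in> W \<and> R a b}"
  have mono: "(a, b) \<in> (?E W)\<^sup>* \<Longrightarrow> (a, b) \<in> (?E (A \<union> B))\<^sup>*" if "W = A \<or> W = B" for a b W
    by (rule subsetD[OF rtrancl_mono]) (use that in auto)
  have AA: "(a, b) \<in> (?E (A \<union> B))\<^sup>*" if "a \<in> A" "b \<in> A" for a b
    using A that mono unfolding conn_def by blast
  have BB: "(a, b) \<in> (?E (A \<union> B))\<^sup>*" if "a \<in> B" "b \<in> B" for a b
    using B that mono unfolding conn_def by blast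
  have e: "(p, q) \<in> (?E (A \<union> B))\<^sup>*" "(q, p) \<in> (?E (A \<union> B))\<^sup>*"
    using p q pq sympD[OF sym pq] by auto
  show ?thesis
    unfolding conn_def
  proof (intro ballI)
    fix a b assume "a \<in> A \<union> B" "b \<in> A \<union> B"
    moreover have "(a, b) \<in> (?E (A \<union> B))\<^sup>*" if "a \<in> A" "b \<in> B"
      using AA[OF that(1) p] e(1) BB[OF q that(2)] by (meson rtrancl_trans)
    moreover have "(a, b) \<in> (?E (A \<union> B))\<^sup>*" if "a \<in> B" "b \<in> A"
      using BB[OF that(1) q] e(2) AA[OF p that(2)] by (meson rtrancl_trans)
    ultimately show "(a, b) \<in> (?E (A \<union> B))\<^sup>*" using AA BB by blast
  qed
qed

lemma conn_insert:
  assumes "conn R A" "p \<in> A" "R p q \<or> q \<in> A" "symp R"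
  shows "conn R (insert q A)"
proof (cases "q \<in> A")
  case True
  then show ?thesis using assms(1) by (simp add: insert_absorb)
next
  case False
  then show ?thesis
    using conn_Un_edge[OF assms(1) conn_singleton assms(2), of q q] assms by auto
qed

text \<open>The closing edge of a cycle is redundant: the other edges of the cycle form a path
  between its ends, so every walk through the deleted edge can be rerouted.\<close>

lemma connected_remove_cycle_edge:
  assumes con: "connected_graph V E" and cyc: "has_cycle E"
  obtains e where "e \<in> E" "connected_graph V (E - {e})"
proof -
  obtain vs where len: "length vs \<ge> 3" and d: "distinct vs"
    and step: "\<And>i. i < length vs - 1 \<Longrightarrow> {vs ! i, vs ! Suc i} \<in> E"
    and close: "{last vs, hd vs} \<in> E"
    using cyc unfolding has_cycle_def by blast
  define e where "e = {last vs, hd vs}"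
  let ?R = "edge_rel (E - {e})"
  have e_alt: "e = {vs ! (length vs - 1), vs ! 0}"
  proof -
    have "vs \<noteq> []" using len by auto
    then show ?thesis by (simp add: e_def last_conv_nth hd_conv_nth)
  qed
  have symR: "sym ?R" by (auto simp: sym_def edge_rel_def insert_commute)
  have path: "i < length vs \<Longrightarrow> (vs ! 0, vs ! i) \<in> ?R\<^sup>*" for i
  proof (induction i)
    case (Suc i)
    have ne: "vs ! i \<noteq> vs ! Suc i"
      using d Suc.prems by (simp add: nth_eq_iff_index_eq)
    \<comment> \<open>By distinctness a path edge equals the closing edge in one of two ways:
      \<open>i\<close> is the last index, which \<open>Suc i < length vs\<close> excludes, or
      \<open>i = 0\<close> and \<open>Suc i\<close> is the last index, which would need a cycle of
      length two.\<close>
    have "{vs ! i, vs ! Suc i} \<noteq> e"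
    proof
      assume "{vs ! i, vs ! Suc i} = e"
      then have "vs ! i = vs ! (length vs - 1) \<and> vs ! Suc i = vs ! 0 \<or>
          vs ! i = vs ! 0 \<and> vs ! Suc i = vs ! (length vs - 1)"
        by (simp add: e_alt doubleton_eq_iff)
      moreover have "i < length vs" "0 < length vs" "length vs - 1 < length vs"
        using Suc.prems by auto
      ultimately show False
        using nth_eq_iff_index_eq[OF d] Suc.prems len by force
    qed
    then have "(vs ! i, vs ! Suc i) \<in> ?R"
      using step[of i] Suc.prems ne by (auto simp: edge_rel_def)
    then show ?case using Suc by (meson Suc_lessD rtrancl_into_rtrancl)
  qed simp
  have p: "(vs ! 0, vs ! (length vs - 1)) \<in> ?R\<^sup>*" using path len by auto
  then have p': "(vs ! (length vs - 1), vs ! 0) \<in> ?R\<^sup>*"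
    using symR by (meson sym_rtrancl symD)
  have "edge_rel E \<subseteq> ?R\<^sup>*"
  proof safe
    fix a b assume ab: "(a, b) \<in> edge_rel E"
    show "(a, b) \<in> ?R\<^sup>*"
    proof (cases "{a, b} = e")
      case True
      then show ?thesis using p p' unfolding e_alt by (auto simp: doubleton_eq_iff)
    next
      case False
      then show ?thesis using ab by (auto simp: edge_rel_def)
    qed
  qed
  then have "(edge_rel E)\<^sup>* \<subseteq> ?R\<^sup>*" by (rule rtrancl_subset_rtrancl)
  then have "connected_graph V (E - {e})"
    using con unfolding connected_graph_def by blast
  then show thesis using close that unfolding e_def by blast
qed

text \<open>Deleting one cycle edge after another preserves connectivity and lowers the number of
  edges, so the process ends without cycles.\<close>

lemma spanning_tree_exists:
  assumes "finite E" "connected_graph V E" "V \<noteq> {}" "\<forall>e\<in>E. e \<subseteq> V"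
  shows "\<exists>E'\<subseteq>E. is_tree V E'"
  using assms
proof (induction "card E" arbitrary: E rule: less_induct)
  case less
  show ?case
  proof (cases "has_cycle E")
    case True
    then obtain e where e: "e \<in> E" "connected_graph V (E - {e})"
      using connected_remove_cycle_edge less.prems(2) by blast
    have "card (E - {e}) < card E" using e less.prems(1) by (intro card_Diff1_less)
    then have "\<exists>E'\<subseteq>E - {e}. is_tree V E'"
      by (rule less.hyps) (use less.prems e in auto)
    then show ?thesis by blast
  next
    case False
    then show ?thesis using less.prems by (auto simp: is_tree_def)
  qed
qed

section \<open>Fans in the hypercube\<close>

definition cube :: "nat \<Rightarrow> bool list set" where
  "cube m = {u. length u = m}"

definition flip :: "bool list \<Rightarrow> nat \<Rightarrow> bool list" where
  "flip u i = u[i := \<not> u ! i]"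

definition qadj :: "bool list \<Rightarrow> bool list \<Rightarrow> bool" where
  "qadj u v \<longleftrightarrow> (\<exists>i<length u. v = flip u i)"

lemma length_flip [simp]: "length (flip u i) = length u"
  by (simp add: flip_def)

lemma flip_Cons [simp]:
  "flip (s # u) 0 = (\<not> s) # u" "flip (s # u) (Suc i) = s # flip u i"
  by (simp_all add: flip_def)

lemma flip_flip [simp]: "flip (flip u i) i = u"
  by (cases "i < length u") (simp_all add: flip_def list_update_beyond)

lemma nth_flip: "j < length u \<Longrightarrow> flip u i ! j = (if i = j then \<not> u ! j else u ! j)"
  by (simp add: flip_def nth_list_update)

lemma flip_neq [simp]: "i < length u \<Longrightarrow> flip u i \<noteq> u" "i < length u \<Longrightarrow> u \<noteq> flip u i"
  by (metis nth_flip)+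

lemma flip_inj: "i < length u \<Longrightarrow> flip u i = flip u j \<longleftrightarrow> i = j"
  by (metis nth_flip)

lemma flip_in_cube [simp]: "flip u i \<in> cube m \<longleftrightarrow> u \<in> cube m"
  by (simp add: cube_def)

lemma symp_qadj: "symp qadj"
  by (auto simp: symp_def qadj_def intro: flip_flip[symmetric])

lemma qadj_flip: "i < length u \<Longrightarrow> qadj u (flip u i)" "i < length u \<Longrightarrow> qadj (flip u i) u"
  using symp_qadj by (auto simp: qadj_def symp_def)

lemma qadj_Cons: "qadj u v \<Longrightarrow> qadj (s # u) (s # v)"
  unfolding qadj_def using flip_Cons(2) by (metis Suc_less_eq length_Cons)

lemma qadj_Cons_neq: "s \<noteq> t \<Longrightarrow> qadj (s # u) (t # u)"
  by (auto simp: qadj_def intro!: exI[of _ 0])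

lemma conn_Cons: "conn qadj X \<Longrightarrow> conn qadj (Cons s ` X)"
  by (erule conn_image) (rule qadj_Cons)

lemma cube_Suc: "cube (Suc m) = Cons True ` cube m \<union> Cons False ` cube m"
  by (auto simp: cube_def length_Suc_conv image_iff)

text \<open>Both facets are connected by induction, and one edge between them, here at the
  all-\<open>True\<close> vertex, joins them.\<close>

lemma conn_cube: "conn qadj (cube m)"
proof (induction m)
  case 0
  have "cube 0 = {[]}" by (auto simp: cube_def)
  then show ?case by simp
next
  case (Suc m)
  have "replicate m True \<in> cube m" by (simp add: cube_def)
  then show ?case
    unfolding cube_Suc
    by (intro conn_Un_edge[where p = "True # replicate m True" and q = "False # replicate m True"]
          conn_Cons Suc symp_qadj qadj_Cons_neq) auto
qed

text \<open>The sets start at the neighbours of \<open>u\<close>, not at \<open>u\<close>, so that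
  they can be disjoint away from \<open>v\<close>. Keeping \<open>u\<close> out of them unless it is
  the target makes it possible to add \<open>u\<close> to one of the sets later.\<close>

definition fan :: "nat \<Rightarrow> bool list \<Rightarrow> bool list \<Rightarrow> (nat \<Rightarrow> bool list set) \<Rightarrow> bool" where
  "fan m u v F \<longleftrightarrow>
     (\<forall>i<m. flip u i \<in> F i \<and> v \<in> F i \<and> F i \<subseteq> cube m \<and> conn qadj (F i) \<and> (u \<in> F i \<longrightarrow> u = v)) \<and>
     (\<forall>i<m. \<forall>j<m. i \<noteq> j \<longrightarrow> F i \<inter> F j = {v})"

lemma fanI:
  assumes "\<And>i. i < m \<Longrightarrow> flip u i \<in> F i \<and> v \<in> F i \<and> F i \<subseteq> cube m \<and> conn qadj (F i) \<and>
      (u \<in> F i \<longrightarrow> u = v)"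
    and "\<And>i j p. i < j \<Longrightarrow> j < m \<Longrightarrow> p \<in> F i \<Longrightarrow> p \<in> F j \<Longrightarrow> p = v"
  shows "fan m u v F"
proof -
  have "F i \<inter> F j = {v}" if "i < m" "j < m" "i \<noteq> j" for i j
  proof -
    have "p = v" if "p \<in> F i" "p \<in> F j" for p
      using assms(2)[of i j p] assms(2)[of j i p] that \<open>i < m\<close> \<open>j < m\<close> \<open>i \<noteq> j\<close> by linarith
    then show ?thesis using assms(1) that by blast
  qed
  then show ?thesis using assms(1) by (simp add: fan_def)
qed

text \<open>Induction on the dimension, splitting off the first coordinate. The rays of a smaller
  fan from \<open>u'\<close> to \<open>v'\<close> are placed into the facet of \<open>u\<close> or
  that of \<open>v\<close>; ray 0 starts in the facet opposite to \<open>u\<close> and needs room of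
  its own.\<close>

lemma fan_exists:
  assumes "length u = m" "length v = m"
  shows "\<exists>F. fan m u v F"
  using assms
proof (induction m arbitrary: u v)
  case 0
  then show ?case by (simp add: fan_def)
next
  case (Suc m)
  obtain s u' t v' where uv: "u = s # u'" "v = t # v'" and len: "length u' = m" "length v' = m"
    using Suc.prems by (auto simp: length_Suc_conv)
  obtain F' where "fan m u' v' F'" using Suc.IH len by blast
  then have F': "\<And>i. i < m \<Longrightarrow> flip u' i \<in> F' i" "\<And>i. i < m \<Longrightarrow> v' \<in> F' i"
      "\<And>i. i < m \<Longrightarrow> F' i \<subseteq> cube m" "\<And>i. i < m \<Longrightarrow> conn qadj (F' i)"
      "\<And>i. i < m \<Longrightarrow> u' \<in> F' i \<Longrightarrow> u' = v'"
      "\<And>i j. i < m \<Longrightarrow> j < m \<Longrightarrow> i \<noteq> j \<Longrightarrow> F' i \<inter> F' j = {v'}"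
    unfolding fan_def by blast+
  have meet: "p = v'" if "p \<in> F' i" "p \<in> F' j" "i < m" "j < m" "i \<noteq> j" for p i j
    using F'(6)[OF that(3-5)] that(1,2) by blast
  have sub: "length p = m" if "p \<in> F' i" "i < m" for p i
    using F'(3)[OF that(2)] that(1) by (auto simp: cube_def)
  consider "s = t" | "s \<noteq> t" "u' = v'" | "s \<noteq> t" "u' \<noteq> v'" by blast
  then show ?case
  proof cases
    case 1
    \<comment> \<open>Both ends lie in the facet \<open>s\<close>: the old rays stay there, and ray
      0 takes the whole opposite facet, which it leaves only towards \<open>v\<close>.\<close>
    define F where "F = case_nat (insert v (Cons (\<not> s) ` cube m)) (\<lambda>i. Cons s ` F' i)"
    have "conn qadj (insert v (Cons (\<not> s) ` cube m))"
      by (rule conn_insert[where p = "(\<not> s) # v'"])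
         (use len in \<open>auto simp: uv 1 conn_Cons conn_cube symp_qadj qadj_Cons_neq cube_def[THEN eqset_imp_iff]\<close>)
    note c0 = this
    have "fan (Suc m) u v F"
    proof (rule fanI)
      fix i assume i: "i < Suc m"
      show "flip u i \<in> F i \<and> v \<in> F i \<and> F i \<subseteq> cube (Suc m) \<and> conn qadj (F i) \<and>
          (u \<in> F i \<longrightarrow> u = v)"
      proof (cases i)
        case 0
        then show ?thesis using c0 len by (auto simp: F_def uv 1 cube_def)
      next
        case (Suc k)
        then show ?thesis using i F'(1,2,5) sub conn_Cons[OF F'(4)] by (auto simp: F_def uv 1 cube_def)
      qed
    next
      fix i j p assume "i < j" "j < Suc m" "p \<in> F i" "p \<in> F j"
      then show "p = v"
        using meet by (cases i; cases j) (auto simp: F_def uv 1)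
    qed
    then show ?thesis by blast
  next
    case 2
    \<comment> \<open>Here \<open>v\<close> is the neighbour of \<open>u\<close> in direction 0.
      Every other ray crosses at once into the facet of \<open>v\<close> and is then one step away
      from \<open>v\<close>.\<close>
    define F where "F = case_nat {v} (\<lambda>i. {v, t # flip u' i, s # flip u' i})"
    have "conn qadj {v, t # flip u' i, s # flip u' i}" if "i < m" for i
    proof -
      have "conn qadj {t # flip u' i, s # flip u' i}"
        by (rule conn_insert[where p = "s # flip u' i"])
           (use 2 symp_qadj qadj_Cons_neq in auto)
      then show ?thesis
        by (rule conn_insert[where p = "t # flip u' i"])
           (use 2 symp_qadj that len in \<open>auto simp: uv intro!: qadj_Cons qadj_flip\<close>)
    qed
    then have "fan (Suc m) u v F"
      by (intro fanI) (use 2 len in \<open>auto simp: F_def uv cube_def flip_inj split: nat.splits\<close>)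
    then show ?thesis by blast
  next
    case 3
    have "m > 0" using 3 len by (cases m) auto
    \<comment> \<open>\<open>k\<close> is the direction from \<open>u'\<close> to \<open>v'\<close>
      if these are adjacent, and arbitrary otherwise.\<close>
    then obtain k where k: "k < m" and k_end: "\<And>i. i < m \<Longrightarrow> v' = flip u' i \<Longrightarrow> i = k"
      using flip_inj len by metis
    \<comment> \<open>Ray 0 borrows \<open>F' k\<close> in the facet of \<open>v\<close>. Ray
      \<open>Suc k\<close> therefore follows its copy of \<open>F' k\<close> in the facet of
      \<open>u\<close> and crosses at \<open>s # v'\<close>, while all other rays cross at once. By
      the choice of \<open>k\<close> no other ray starts at \<open>s # v'\<close>.\<close>
    define F where "F = case_nat (insert (t # u') (Cons t ` F' k))
      (\<lambda>i. if i = k then insert v (Cons s ` F' k) else insert (s # flip u' i) (Cons t ` F' i))"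
    have c0: "conn qadj (insert (t # u') (Cons t ` F' k))"
      by (rule conn_insert[where p = "t # flip u' k"])
         (use F' k len symp_qadj in \<open>auto intro!: conn_Cons qadj_Cons qadj_flip\<close>)
    have ck: "conn qadj (insert v (Cons s ` F' k))"
      by (rule conn_insert[where p = "s # v'"])
         (use 3 F' k symp_qadj in \<open>auto simp: uv intro!: conn_Cons qadj_Cons_neq\<close>)
    have ci: "conn qadj (insert (s # flip u' i) (Cons t ` F' i))" if "i < m" for i
      by (rule conn_insert[where p = "t # flip u' i"])
         (use 3 F' that symp_qadj in \<open>auto intro!: conn_Cons qadj_Cons_neq\<close>)
    have notin: "flip u' i \<notin> F' k" if "i < m" "i \<noteq> k" for i
      using meet[OF F'(1)[OF that(1)] _ that(1) k that(2)] k_end[OF that(1)] that(2) by metis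
    have un: "u' \<notin> F' i" if "i < m" for i using F'(5) that 3 by blast
    have "fan (Suc m) u v F"
    proof (rule fanI)
      fix i assume "i < Suc m"
      then show "flip u i \<in> F i \<and> v \<in> F i \<and> F i \<subseteq> cube (Suc m) \<and> conn qadj (F i) \<and>
          (u \<in> F i \<longrightarrow> u = v)"
        using F'(1,2) c0 ck ci k un sub 3 len
        by (cases i) (auto simp: F_def uv cube_def)
    next
      fix i j p assume "i < j" "j < Suc m" "p \<in> F i" "p \<in> F j"
      then show "p = v"
        using 3 len k notin un meet
        by (cases i; cases j) (auto simp: F_def uv flip_inj split: if_splits)
    qed
    then show ?thesis by blast
  qed
qed

text \<open>Since \<open>a\<close> is injective, the centre \<open>u\<close> is added to at most one
  of the sets, and any other set containing \<open>u\<close> forces \<open>u = v\<close>. A contact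
  \<open>flip u i\<close> belongs to its set already.\<close>

lemma contacts_insert_meet:
  assumes F: "fan m u v F" and a: "inj_on a {..<m}" "\<And>i. i < m \<Longrightarrow> a i = u \<or> a i = flip u i"
    and ij: "i < m" "j < m" "i \<noteq> j" and p: "p \<in> insert (a i) (F i)" "p \<in> insert (a j) (F j)"
  shows "p = v"
proof -
  have meet: "q = v" if "q \<in> F i" "q \<in> F j" for q
    using F ij that unfolding fan_def by blast
  have "a i \<noteq> a j" using a(1) ij by (auto simp: inj_on_def)
  moreover have "flip u i \<in> F i" "flip u j \<in> F j" "u \<in> F i \<Longrightarrow> u = v" "u \<in> F j \<Longrightarrow> u = v"
    using F ij unfolding fan_def by blast+
  ultimately show ?thesis
    using p a(2)[OF ij(1)] a(2)[OF ij(2)] meet by (metis insert_iff)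
qed

lemma conn_fan_insert:
  assumes "fan m u v F" "i < m" "length u = m" "a = u \<or> a = flip u i"
  shows "conn qadj (insert a (F i))"
  by (rule conn_insert[where p = "flip u i"])
     (use assms symp_qadj qadj_flip in \<open>auto simp: fan_def\<close>)

text \<open>The endpoint of the \<open>i\<close>-th ray is chosen on the path from \<open>v\<close> over \<open>v + e\<^sub>i\<close> to
  \<open>v + e\<^sub>i + e\<^sub>i\<^sub>+\<^sub>1\<close> (cyclically); at most one of these paths has both \<open>b\<close> and \<open>b'\<close>
  beyond \<open>v\<close>, and that one may end in \<open>v\<close>.\<close>

lemma fan_avoiding:
  assumes v: "length v = m" and m: "m \<ge> 3"
  obtains \<beta> G where "inj_on \<beta> {..<m}"
    "\<And>i. i < m \<Longrightarrow> \<beta> i \<noteq> b \<and> \<beta> i \<noteq> b' \<and> \<beta> i \<in> G i \<and> v \<in> G i \<and> G i \<subseteq> cube m \<and> conn qadj (G i)"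
    "\<And>i j p. i < m \<Longrightarrow> j < m \<Longrightarrow> i \<noteq> j \<Longrightarrow> p \<in> G i \<Longrightarrow> p \<in> G j \<Longrightarrow> p = v"
proof -
  define nxt where "nxt i = (if Suc i = m then 0 else Suc i)" for i
  define f where "f i = flip v i" for i
  define g where "g i = flip (f i) (nxt i)" for i
  define G where "G i = {v, f i, g i}" for i
  define \<beta> where "\<beta> i = (if f i \<notin> {b, b'} then f i else if g i \<notin> {b, b'} then g i else v)" for i
  \<comment> \<open>The set of coordinates in which a vertex differs from \<open>v\<close>; it tells
    the points \<open>f i\<close> and \<open>g i\<close> of all rays apart.\<close>
  define D where "D u = {l. l < m \<and> u ! l \<noteq> v ! l}" for u
  have nxt: "nxt i < m" "nxt i \<noteq> i" if "i < m" for i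
    using that m by (auto simp: nxt_def)
  have Dv: "D v = {}" by (simp add: D_def)
  have Df: "D (f i) = {i}" if "i < m" for i
    using that v by (auto simp: D_def f_def nth_flip split: if_splits)
  have Dg: "D (g i) = {i, nxt i}" if "i < m" for i
    using that v nxt[OF that] by (auto simp: D_def f_def g_def nth_flip split: if_splits)
  have fv: "f i \<noteq> v" "g i \<noteq> v" if "i < m" for i
    using Dv Df[OF that] Dg[OF that] by auto
  have ff: "f i \<noteq> f j" if "i < m" "j < m" "i \<noteq> j" for i j
    using Df that by (metis singleton_inject)
  have fg: "f i \<noteq> g j" if "i < m" "j < m" for i j
    using Df[OF that(1)] Dg[OF that(2)] nxt[OF that(2)] by (metis insertI1 insert_commute singletonD)
  have gg: "g i \<noteq> g j" if "i < m" "j < m" "i \<noteq> j" for i j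
  proof
    assume "g i = g j"
    then have "{i, nxt i} = {j, nxt j}" using Dg that by metis
    \<comment> \<open>Equality of the two pairs would give \<open>nxt i = j\<close> and
      \<open>nxt j = i\<close>, a cyclic order on just two indices, which \<open>m \<ge> 3\<close>
      excludes.\<close>
    then show False using that m by (auto simp: doubleton_eq_iff nxt_def split: if_splits)
  qed
  have meet: "p = v" if "i < m" "j < m" "i \<noteq> j" "p \<in> G i" "p \<in> G j" for i j p
    using that ff[OF that(1-3)] gg[OF that(1-3)] fg[OF that(1,2)] fg[OF that(2,1)] by (auto simp: G_def)
  have conn: "conn qadj (G i)" if "i < m" for i
  proof -
    have "conn qadj {f i, g i}"
      by (rule conn_insert[where p = "g i"])
         (use nxt that v symp_qadj in \<open>auto simp: g_def f_def intro!: qadj_flip\<close>)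
    then show ?thesis unfolding G_def
      by (rule conn_insert[where p = "f i"])
         (use that v symp_qadj in \<open>auto simp: f_def intro!: qadj_flip\<close>)
  qed
  have "inj_on \<beta> {..<m}"
  proof (rule inj_onI, rule ccontr)
    fix i j assume ij: "i \<in> {..<m}" "j \<in> {..<m}" "\<beta> i = \<beta> j" "i \<noteq> j"
    then have "\<beta> i = v" "\<beta> j = v"
      using meet[of i j "\<beta> i"] by (auto simp: G_def \<beta>_def split: if_splits)
    then have "{f i, g i} \<subseteq> {b, b'}" "{f j, g j} \<subseteq> {b, b'}"
      using ij fv[of i] fv[of j] by (auto simp: \<beta>_def split: if_splits)
    then show False using ij ff[of i j] gg[of i j] fg[of i j] fg[of i i] fg[of j i] by auto
  qed
  \<comment> \<open>If the ray ends in \<open>v\<close>, then \<open>f i\<close> and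
    \<open>g i\<close> are two different members of \<open>{b, b'}\<close> and exhaust it, so
    \<open>v\<close> is neither \<open>b\<close> nor \<open>b'\<close>.\<close>
  moreover have "\<beta> i \<noteq> b \<and> \<beta> i \<noteq> b' \<and> \<beta> i \<in> G i \<and> v \<in> G i \<and> G i \<subseteq> cube m \<and> conn qadj (G i)"
    if "i < m" for i
    using that conn fv[OF that] fg[OF that that] v
    by (auto simp: G_def \<beta>_def f_def g_def cube_def split: if_splits)
  ultimately show thesis using meet that by blast
qed

section \<open>Tree packings in the dual cube\<close>

type_synonym dvert = "bool list \<times> bool list \<times> bool"

definition dverts :: "nat \<Rightarrow> dvert set" where
  "dverts m = {(a, b, t). a \<in> cube m \<and> b \<in> cube m}"

definition dadj :: "nat \<Rightarrow> dvert \<Rightarrow> dvert \<Rightarrow> bool" where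
  "dadj m = (\<lambda>(a, b, s) (a', b', t). a \<in> cube m \<and> b \<in> cube m \<and> a' \<in> cube m \<and> b' \<in> cube m \<and>
     (if s = t then if s then a = a' \<and> qadj b b' else b = b' \<and> qadj a a' else a = a' \<and> b = b'))"

text \<open>Edges between two terminals are reserved for the one tree whose flag \<open>e\<close> is set: this makes
  the trees edge-disjoint as soon as their vertex sets meet only in \<open>S\<close>.\<close>

definition link :: "nat \<Rightarrow> dvert set \<Rightarrow> bool \<Rightarrow> dvert \<Rightarrow> dvert \<Rightarrow> bool" where
  "link m S e p q \<longleftrightarrow> dadj m p q \<and> (e \<or> p \<notin> S \<or> q \<notin> S)"

definition row :: "bool list \<Rightarrow> bool list set \<Rightarrow> dvert set" where
  "row b X = (\<lambda>a. (a, b, False)) ` X"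

definition col :: "bool list \<Rightarrow> bool list set \<Rightarrow> dvert set" where
  "col a Y = (\<lambda>b. (a, b, True)) ` Y"

text \<open>Connected vertex sets stand in for the trees; a spanning tree of each is chosen only
  after the transfer to \<open>D_n\<close>.\<close>

definition packing :: "nat \<Rightarrow> dvert set \<Rightarrow> bool" where
  "packing m S \<longleftrightarrow> (\<exists>W e.
     (\<forall>i<m. S \<subseteq> W i \<and> W i \<subseteq> dverts m \<and> conn (link m S (e i)) (W i)) \<and>
     (\<forall>i<m. \<forall>j<m. i \<noteq> j \<longrightarrow> W i \<inter> W j \<subseteq> S \<and> \<not> (e i \<and> e j)))"

lemma in_row [simp]: "(p, c, t) \<in> row b X \<longleftrightarrow> p \<in> X \<and> c = b \<and> \<not> t"
  by (auto simp: row_def)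

lemma in_col [simp]: "(c, p, t) \<in> col a Y \<longleftrightarrow> p \<in> Y \<and> c = a \<and> t"
  by (auto simp: col_def)

lemma row_subset [simp]: "b \<in> cube m \<Longrightarrow> X \<subseteq> cube m \<Longrightarrow> row b X \<subseteq> dverts m"
  by (auto simp: row_def dverts_def)

lemma col_subset [simp]: "a \<in> cube m \<Longrightarrow> Y \<subseteq> cube m \<Longrightarrow> col a Y \<subseteq> dverts m"
  by (auto simp: col_def dverts_def)

lemma not_qadj_refl [simp]: "\<not> qadj u u"
  by (auto simp: qadj_def)

lemma symp_dadj: "symp (dadj m)"
  using symp_qadj by (auto simp: symp_def dadj_def split: if_splits)

lemma symp_link: "symp (link m S e)"
  using symp_dadj[of m] by (auto simp: symp_def link_def)

text \<open>The last assumption keeps edges between terminals out of the piece: an edge has distinct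
  ends, so they cannot both be terminals unless the flag is set.\<close>

lemma conn_row:
  assumes "conn qadj X" "X \<subseteq> cube m" "b \<in> cube m"
    and "\<And>p q. \<not> e \<Longrightarrow> p \<in> X \<Longrightarrow> q \<in> X \<Longrightarrow> (p, b, False) \<in> S \<Longrightarrow> (q, b, False) \<in> S \<Longrightarrow> p = q"
  shows "conn (link m S e) (row b X)"
  unfolding row_def
  by (rule conn_image[OF assms(1)]) (use assms(2-) not_qadj_refl in \<open>fastforce simp: link_def dadj_def\<close>)

lemma conn_col:
  assumes "conn qadj Y" "Y \<subseteq> cube m" "a \<in> cube m"
    and "\<And>p q. \<not> e \<Longrightarrow> p \<in> Y \<Longrightarrow> q \<in> Y \<Longrightarrow> (a, p, True) \<in> S \<Longrightarrow> (a, q, True) \<in> S \<Longrightarrow> p = q"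
  shows "conn (link m S e) (col a Y)"
  unfolding col_def
  by (rule conn_image[OF assms(1)]) (use assms(2-) not_qadj_refl in \<open>fastforce simp: link_def dadj_def\<close>)

lemma link_cross:
  assumes "a \<in> cube m" "b \<in> cube m" "e \<or> (a, b, False) \<notin> S \<or> (a, b, True) \<notin> S"
  shows "link m S e (a, b, False) (a, b, True)" "link m S e (a, b, True) (a, b, False)"
  using assms by (auto simp: link_def dadj_def)

text \<open>As \<open>x\<close> is not in \<open>F i\<close>, the part over \<open>F i\<close> holds
  at most the terminal \<open>y\<close>. The edge attaching \<open>x\<close> goes to
  \<open>flip x i\<close>, so it joins two terminals only if \<open>flip x i = y\<close>, which is
  exactly the flag.\<close>

lemma conn_terminal_row:
  assumes F: "fan m x y F" and "i < m" "x \<noteq> y" "x \<in> cube m" "b \<in> cube m"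
    and S: "\<And>p. (p, b, False) \<in> S \<Longrightarrow> p = x \<or> p = y"
  shows "conn (link m S (flip x i = y)) (row b (insert x (F i)))"
proof -
  have Fi: "flip x i \<in> F i" "F i \<subseteq> cube m" "conn qadj (F i)" "x \<notin> F i"
    using F assms(2,3) unfolding fan_def by blast+
  have "row b (insert x (F i)) = insert (x, b, False) (row b (F i))"
    by (auto simp: row_def)
  moreover have "conn (link m S (flip x i = y)) (insert (x, b, False) (row b (F i)))"
  proof (rule conn_insert[OF _ _ _ symp_link])
    show "conn (link m S (flip x i = y)) (row b (F i))"
      by (rule conn_row) (use Fi assms S in auto)
    show "(flip x i, b, False) \<in> row b (F i)" using Fi by simp
    have "flip x i \<noteq> x" using assms by (simp add: cube_def)
    then have "link m S (flip x i = y) (flip x i, b, False) (x, b, False)"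
      using assms S[of "flip x i"] by (auto simp: link_def dadj_def cube_def intro!: qadj_flip)
    then show "link m S (flip x i = y) (flip x i, b, False) (x, b, False) \<or>
        (x, b, False) \<in> row b (F i)" ..
  qed
  ultimately show ?thesis by simp
qed

text \<open>The flag of tree \<open>i\<close> is \<open>flip x i = y\<close>. At most one tree has
  it set, because different directions lead to different neighbours.\<close>

lemma packingI:
  assumes "\<And>i. i < m \<Longrightarrow> S \<subseteq> W i" "\<And>i. i < m \<Longrightarrow> W i \<subseteq> dverts m"
    and "\<And>i. i < m \<Longrightarrow> conn (link m S (flip x i = y)) (W i)"
    and "\<And>i j p. i < m \<Longrightarrow> j < m \<Longrightarrow> i \<noteq> j \<Longrightarrow> p \<in> W i \<Longrightarrow> p \<in> W j \<Longrightarrow> p \<in> S"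
    and "x \<in> cube m"
  shows "packing m S"
  unfolding packing_def
proof (intro exI conjI)
  show "\<forall>i<m. S \<subseteq> W i \<and> W i \<subseteq> dverts m \<and> conn (link m S (flip x i = y)) (W i)"
    using assms by blast
  show "\<forall>i<m. \<forall>j<m. i \<noteq> j \<longrightarrow> W i \<inter> W j \<subseteq> S \<and> \<not> (flip x i = y \<and> flip x j = y)"
    using assms(4,5) flip_inj[of _ x] by (fastforce simp: cube_def)
qed

section \<open>Packings for the possible classes of the two remaining terminals\<close>

lemma fanD:
  assumes "fan m u v F"
  shows "\<And>i. i < m \<Longrightarrow> flip u i \<in> F i" "\<And>i. i < m \<Longrightarrow> v \<in> F i"
    "\<And>i. i < m \<Longrightarrow> F i \<subseteq> cube m" "\<And>i. i < m \<Longrightarrow> conn qadj (F i)"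
    "\<And>i. i < m \<Longrightarrow> u \<in> F i \<Longrightarrow> u = v"
    "\<And>i j p. i < m \<Longrightarrow> j < m \<Longrightarrow> i \<noteq> j \<Longrightarrow> p \<in> F i \<Longrightarrow> p \<in> F j \<Longrightarrow> p = v"
  using assms unfolding fan_def by blast+

text \<open>The contact falls back to \<open>x\<close> when the neighbour is \<open>y\<close> or the
  column \<open>c\<close> to be avoided. The second assumption ensures that this happens for at most
  one index. Taking \<open>c = y\<close> avoids \<open>y\<close> alone.\<close>

lemma contacts_avoiding:
  assumes "x \<in> cube m" "\<And>i j. i < m \<Longrightarrow> j < m \<Longrightarrow> flip x i = y \<Longrightarrow> flip x j = c \<Longrightarrow> i = j"
  defines "a \<equiv> \<lambda>i. if flip x i = y \<or> flip x i = c then x else flip x i"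
  shows "inj_on a {..<m}" "\<And>i. a i = x \<or> a i = flip x i" "\<And>i. a i \<in> cube m"
proof -
  have len: "length x = m" using assms(1) by (simp add: cube_def)
  show "inj_on a {..<m}"
  proof (rule inj_onI)
    fix i j assume ij: "i \<in> {..<m}" "j \<in> {..<m}" "a i = a j"
    then show "i = j"
      using flip_inj[of i x j] assms(2)[of i j] assms(2)[of j i] len
      by (auto simp: a_def split: if_splits)
  qed
  show "\<And>i. a i = x \<or> a i = flip x i" by (simp add: a_def)
  show "\<And>i. a i \<in> cube m" using assms(1) by (simp add: a_def)
qed

text \<open>All terminals lie in rows, so tree \<open>i\<close> may take its whole column
  \<open>a i\<close> and enters the rows \<open>b'\<close> and \<open>b''\<close> at
  \<open>a i\<close>. The fans there are centred at \<open>x\<close>, which matches the entry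
  points.\<close>

lemma packing_same_class:
  assumes cube: "x \<in> cube m" "y \<in> cube m" "z \<in> cube m" "w \<in> cube m"
      "b \<in> cube m" "b' \<in> cube m" "b'' \<in> cube m"
    and ne: "x \<noteq> y" "b \<noteq> b'" "b \<noteq> b''" "b' \<noteq> b''"
  shows "packing m {(x, b, False), (y, b, False), (z, b', False), (w, b'', False)}" (is "packing m ?S")
proof -
  obtain F H K where F: "fan m x y F" and H: "fan m x z H" and K: "fan m x w K"
    using fan_exists[of x m y] fan_exists[of x m z] fan_exists[of x m w] cube
    by (auto simp: cube_def)
  define a where "a i = (if flip x i = y then x else flip x i)" for i
  have same: "i = j" if "i < m" "flip x i = y" "flip x j = y" for i j
    using flip_inj[of i x j] that cube by (simp add: cube_def)
  have a: "inj_on a {..<m}" "\<And>i. a i = x \<or> a i = flip x i" "\<And>i. a i \<in> cube m"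
    using contacts_avoiding[of x m y y] same by (auto simp: a_def[abs_def] cube)
  have aF: "a i \<in> insert x (F i)" if "i < m" for i
    using a(2)[of i] fanD(1)[OF F that] by auto
  define W where "W i = row b (insert x (F i)) \<union> col (a i) (cube m) \<union> row b' (insert (a i) (H i)) \<union>
    row b'' (insert (a i) (K i))" for i
  show ?thesis
  proof (rule packingI[where W = W and x = x and y = y])
    fix i assume i: "i < m"
    note facts = fanD[OF F] fanD[OF H] fanD[OF K]
    show "?S \<subseteq> W i" using facts i by (auto simp: W_def)
    show "W i \<subseteq> dverts m"
      using facts i cube a(3) by (auto simp: W_def intro!: subsetD[OF row_subset] subsetD[OF col_subset])
    show "conn (link m ?S (flip x i = y)) (W i)"
      unfolding W_def
    proof (intro conn_Un_edge[OF _ _ _ _ _ symp_link])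
      show "conn (link m ?S (flip x i = y)) (row b (insert x (F i)))"
        by (rule conn_terminal_row) (use F i cube ne in auto)
      show "conn (link m ?S (flip x i = y)) (col (a i) (cube m))"
        by (rule conn_col) (use a(3) conn_cube in auto)
      show "conn (link m ?S (flip x i = y)) (row b' (insert (a i) (H i)))"
        by (rule conn_row[OF conn_fan_insert[OF H i]]) (use facts i a cube ne in \<open>auto simp: cube_def\<close>)
      show "conn (link m ?S (flip x i = y)) (row b'' (insert (a i) (K i)))"
        by (rule conn_row[OF conn_fan_insert[OF K i]]) (use facts i a cube ne in \<open>auto simp: cube_def\<close>)
      show "link m ?S (flip x i = y) (a i, b, False) (a i, b, True)"
        "link m ?S (flip x i = y) (a i, b', True) (a i, b', False)"
        "link m ?S (flip x i = y) (a i, b'', True) (a i, b'', False)"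
        by (rule link_cross; use a cube in simp)+
    qed (use aF i cube in auto)
  next
    fix i j p assume ij: "i < m" "j < m" "i \<noteq> j" and p: "p \<in> W i" "p \<in> W j"
    have "a i \<noteq> a j" using a(1) ij by (auto simp: inj_on_def)
    then show "p \<in> ?S"
      using p ne fanD(6)[OF F ij] contacts_insert_meet[OF H a(1,2) ij] contacts_insert_meet[OF K a(1,2) ij]
      by (cases p) (auto simp: W_def)
  qed (use cube in auto)
qed

text \<open>Tree \<open>i\<close> reaches the column \<open>c\<close> through the whole row
  \<open>\<beta> i\<close>, which contains no terminal since it avoids \<open>b\<close> and
  \<open>b'\<close>. The contact columns are used entirely, so they must differ from
  \<open>c\<close>: \<open>c1\<close> keeps the contacts injective after the fallback to
  \<open>x\<close>, and \<open>c2\<close> covers the case that \<open>x\<close> serves as a contact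
  because of \<open>y\<close>.\<close>

lemma packing_one_opposite_aux:
  assumes cube: "x \<in> cube m" "y \<in> cube m" "z \<in> cube m" "w \<in> cube m"
      "b \<in> cube m" "b' \<in> cube m" "c \<in> cube m"
    and ne: "x \<noteq> y" "b \<noteq> b'" and m: "m \<ge> 3"
    and c1: "\<And>i j. i < m \<Longrightarrow> j < m \<Longrightarrow> flip x i = y \<Longrightarrow> flip x j = c \<Longrightarrow> i = j"
    and c2: "\<And>i. i < m \<Longrightarrow> flip x i = y \<Longrightarrow> c \<noteq> x"
  shows "packing m {(x, b, False), (y, b, False), (z, b', False), (c, w, True)}" (is "packing m ?S")
proof -
  obtain F H where F: "fan m x y F" and H: "fan m x z H"
    using fan_exists[of x m y] fan_exists[of x m z] cube by (auto simp: cube_def)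
  have "length w = m" using cube by (simp add: cube_def)
  then obtain \<beta> G where \<beta>: "inj_on \<beta> {..<m}"
    and G: "\<And>i. i < m \<Longrightarrow> \<beta> i \<noteq> b \<and> \<beta> i \<noteq> b' \<and> \<beta> i \<in> G i \<and> w \<in> G i \<and> G i \<subseteq> cube m \<and> conn qadj (G i)"
    and G_meet: "\<And>i j p. i < m \<Longrightarrow> j < m \<Longrightarrow> i \<noteq> j \<Longrightarrow> p \<in> G i \<Longrightarrow> p \<in> G j \<Longrightarrow> p = w"
    using fan_avoiding[OF _ m, of w b b'] by blast
  have \<beta>_cube: "\<beta> i \<in> cube m" if "i < m" for i using G[OF that] by blast
  define a where "a i = (if flip x i = y \<or> flip x i = c then x else flip x i)" for i
  have a_eq: "a = (\<lambda>i. if flip x i = y \<or> flip x i = c then x else flip x i)"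
    by (simp add: a_def fun_eq_iff)
  have a: "inj_on a {..<m}" "\<And>i. a i = x \<or> a i = flip x i" "\<And>i. a i \<in> cube m"
    using contacts_avoiding[OF cube(1) c1] unfolding a_eq by simp_all
  have ac: "a i \<noteq> c" if "i < m" for i
  proof -
    have "flip x i \<noteq> x" using that cube(1) by (simp add: cube_def)
    then show ?thesis using c2[OF that] unfolding a_def by metis
  qed
  have aF: "a i \<in> insert x (F i)" if "i < m" for i
    using a(2)[of i] fanD(1)[OF F that] by auto
  define W where "W i = row b (insert x (F i)) \<union> col (a i) (cube m) \<union> row b' (insert (a i) (H i)) \<union>
    row (\<beta> i) (cube m) \<union> col c (G i)" for i
  show ?thesis
  proof (rule packingI[where W = W and x = x and y = y])
    fix i assume i: "i < m"
    note facts = fanD[OF F] fanD[OF H]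
    show "?S \<subseteq> W i" using facts i G[OF i] by (auto simp: W_def)
    show "W i \<subseteq> dverts m"
      using facts i cube a(3) G[OF i] \<beta>_cube[OF i]
      by (auto simp: W_def intro!: subsetD[OF row_subset] subsetD[OF col_subset])
    show "conn (link m ?S (flip x i = y)) (W i)"
      unfolding W_def
    proof (intro conn_Un_edge[OF _ _ _ _ _ symp_link])
      show "conn (link m ?S (flip x i = y)) (row b (insert x (F i)))"
        by (rule conn_terminal_row) (use F i cube ne in auto)
      show "conn (link m ?S (flip x i = y)) (col (a i) (cube m))"
        by (rule conn_col) (use a(3) conn_cube ac[OF i] in auto)
      show "conn (link m ?S (flip x i = y)) (row b' (insert (a i) (H i)))"
        by (rule conn_row[OF conn_fan_insert[OF H i]]) (use facts i a cube ne in \<open>auto simp: cube_def\<close>)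
      show "conn (link m ?S (flip x i = y)) (row (\<beta> i) (cube m))"
        by (rule conn_row) (use \<beta>_cube[OF i] conn_cube G[OF i] in auto)
      show "conn (link m ?S (flip x i = y)) (col c (G i))"
        by (rule conn_col) (use cube G[OF i] in auto)
      show "link m ?S (flip x i = y) (a i, b, False) (a i, b, True)"
        "link m ?S (flip x i = y) (a i, b', True) (a i, b', False)"
        "link m ?S (flip x i = y) (a i, \<beta> i, True) (a i, \<beta> i, False)"
        "link m ?S (flip x i = y) (c, \<beta> i, False) (c, \<beta> i, True)"
        by (rule link_cross; use a cube ac[OF i] G[OF i] \<beta>_cube[OF i] in simp)+
    qed (use aF i cube a(3) G[OF i] \<beta>_cube[OF i] in auto)
  next
    fix i j p assume ij: "i < m" "j < m" "i \<noteq> j" and p: "p \<in> W i" "p \<in> W j"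
    have "a i \<noteq> a j" "\<beta> i \<noteq> \<beta> j" using a(1) \<beta> ij by (auto simp: inj_on_def)
    then show "p \<in> ?S"
      using p ne fanD(6)[OF F ij] contacts_insert_meet[OF H a(1,2) ij] G_meet[OF ij]
        G[OF ij(1)] G[OF ij(2)] ac[OF ij(1)] ac[OF ij(2)]
      by (cases p) (auto simp: W_def)
  qed (use cube in auto)
qed

text \<open>Two flips change an even number of coordinates, a single flip an odd number.\<close>

lemma flip_no_triangle:
  assumes "i < length u" "j < length u" "k < length u" "flip u i = v" "flip u j = w" "flip v k = w"
  shows False
proof -
  have nth: "flip (flip u i) k ! l = flip u j ! l" for l using assms by simp
  show False
    using nth[of i] nth[of j] nth[of k] assms(1-3) by (auto simp: nth_flip split: if_splits)
qed

lemma packing_one_opposite: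
  assumes cube: "x \<in> cube m" "y \<in> cube m" "z \<in> cube m" "w \<in> cube m"
      "b \<in> cube m" "b' \<in> cube m" "c \<in> cube m"
    and ne: "x \<noteq> y" "b \<noteq> b'" and m: "m \<ge> 3"
  shows "packing m {(x, b, False), (y, b, False), (z, b', False), (c, w, True)}"
proof -
  \<comment> \<open>\<open>?bad x y\<close> says that the assumptions \<open>c1\<close> or
    \<open>c2\<close> of the auxiliary packing fail when the contacts are taken around
    \<open>x\<close>.\<close>
  let ?bad = "\<lambda>x y. \<exists>i<m. flip x i = y \<and> (c = x \<or> (\<exists>j<m. j \<noteq> i \<and> flip x j = c))"
  have len: "length x = m" "length y = m" using cube by (auto simp: cube_def)
  \<comment> \<open>The contacts must avoid \<open>c\<close>; since Q has no triangles, this works from \<open>x\<close> or from \<open>y\<close>.\<close>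
  have "\<not> (?bad x y \<and> ?bad y x)"
  proof
    assume "?bad x y \<and> ?bad y x"
    then obtain i k where i: "i < m" "flip x i = y" "c = x \<or> (\<exists>j<m. j \<noteq> i \<and> flip x j = c)"
      and k: "k < m" "flip y k = x" "c = y \<or> (\<exists>j<m. j \<noteq> k \<and> flip y j = c)" by blast
    \<comment> \<open>This rules out \<open>c = x\<close>, and the next fact rules out
      \<open>c = y\<close>. What remains is a common neighbour \<open>c\<close> of the adjacent
      vertices \<open>x\<close> and \<open>y\<close>.\<close>
    have "\<not> (\<exists>j<m. j \<noteq> k \<and> flip y j = x)" using k len flip_inj[of k y] by metis
    moreover have "\<not> (\<exists>j<m. j \<noteq> i \<and> flip x j = y)" using i len flip_inj[of i x] by metis
    ultimately obtain j l where "j < m" "flip x j = c" "l < m" "flip y l = c"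
      using i(3) k(3) ne by blast
    then show False using flip_no_triangle[of i x j l y c] i len by auto
  qed
  then consider "\<not> ?bad x y" | "\<not> ?bad y x" by blast
  then show ?thesis
  proof cases
    case 1
    then show ?thesis by (intro packing_one_opposite_aux assms) metis+
  next
    case 2
    then have "packing m {(y, b, False), (x, b, False), (z, b', False), (c, w, True)}"
      by (intro packing_one_opposite_aux assms ne(1)[symmetric]) metis+
    then show ?thesis by (simp add: insert_commute)
  qed
qed

text \<open>The rows \<open>flip b i\<close> are distinct and differ from \<open>b\<close>, so they
  hold no terminal and each tree can own one entirely. They meet the columns \<open>c\<close> and
  \<open>d\<close> in the neighbours of \<open>b\<close>, hence fans centred at \<open>b\<close>
  lead on to \<open>z\<close> and \<open>w\<close>.\<close>

lemma packing_two_opposite: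
  assumes cube: "x \<in> cube m" "y \<in> cube m" "z \<in> cube m" "w \<in> cube m"
      "b \<in> cube m" "c \<in> cube m" "d \<in> cube m"
    and ne: "x \<noteq> y" "c \<noteq> d"
  shows "packing m {(x, b, False), (y, b, False), (c, z, True), (d, w, True)}" (is "packing m ?S")
proof -
  obtain F H K where F: "fan m x y F" and H: "fan m b z H" and K: "fan m b w K"
    using fan_exists[of x m y] fan_exists[of b m z] fan_exists[of b m w] cube
    by (auto simp: cube_def)
  have bl: "length b = m" using cube by (simp add: cube_def)
  define a where "a i = (if flip x i = y then x else flip x i)" for i
  have same: "i = j" if "i < m" "flip x i = y" "flip x j = y" for i j
    using flip_inj[of i x j] that cube by (simp add: cube_def)
  have a: "inj_on a {..<m}" "\<And>i. a i = x \<or> a i = flip x i" "\<And>i. a i \<in> cube m"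
    using contacts_avoiding[of x m y y] same by (auto simp: a_def[abs_def] cube)
  \<comment> \<open>The cross edge at the contact may end in a terminal of class 1, namely if
    \<open>a i\<close> is \<open>c\<close> or \<open>d\<close> and \<open>b\<close> is
    \<open>z\<close> or \<open>w\<close>. Its other end is a terminal only in the tree whose flag is
    set.\<close>
  have aS: "flip x i = y \<or> a i \<noteq> x \<and> a i \<noteq> y" if "i < m" for i
    using that cube by (auto simp: a_def cube_def)
  have aF: "a i \<in> insert x (F i)" if "i < m" for i
    using a(2)[of i] fanD(1)[OF F that] by auto
  \<comment> \<open>If the contact column is the column of a terminal, only the fan of tree \<open>i\<close> may be used there.\<close>
  define M where "M i = (if a i = c then insert b (H i) else if a i = d then insert b (K i) else cube m)" for i
  have M: "b \<in> M i" "flip b i \<in> M i" "M i \<subseteq> cube m" "conn qadj (M i)" if "i < m" for i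
    using that fanD(1,3)[OF H that] fanD(1,3)[OF K that] cube conn_cube
      conn_fan_insert[OF H that bl, of b] conn_fan_insert[OF K that bl, of b]
    by (auto simp: M_def)
  define W where "W i = row b (insert x (F i)) \<union> col (a i) (M i) \<union> row (flip b i) (cube m) \<union>
    col c (H i) \<union> col d (K i)" for i
  show ?thesis
  proof (rule packingI[where W = W and x = x and y = y])
    fix i assume i: "i < m"
    note facts = fanD[OF F] fanD[OF H] fanD[OF K]
    have fb: "flip b i \<noteq> b" using i bl by simp
    show "?S \<subseteq> W i" using facts i by (auto simp: W_def)
    show "W i \<subseteq> dverts m"
      using facts(1-4) facts(7-10) facts(13-16) i cube a(3) M(3)[OF i]
      by (auto simp: W_def intro!: subsetD[OF row_subset] subsetD[OF col_subset])
    show "conn (link m ?S (flip x i = y)) (W i)"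
      unfolding W_def
    proof (intro conn_Un_edge[OF _ _ _ _ _ symp_link])
      show "conn (link m ?S (flip x i = y)) (row b (insert x (F i)))"
        by (rule conn_terminal_row) (use F i cube ne in auto)
      show "conn (link m ?S (flip x i = y)) (col (a i) (M i))"
        by (rule conn_col) (use a(3) M[OF i] ne in auto)
      show "conn (link m ?S (flip x i = y)) (row (flip b i) (cube m))"
        by (rule conn_row) (use cube conn_cube fb in auto)
      show "conn (link m ?S (flip x i = y)) (col c (H i))"
        by (rule conn_col) (use cube facts i ne in auto)
      show "conn (link m ?S (flip x i = y)) (col d (K i))"
        by (rule conn_col) (use cube facts i ne in auto)
      show "link m ?S (flip x i = y) (a i, b, False) (a i, b, True)"
        "link m ?S (flip x i = y) (a i, flip b i, True) (a i, flip b i, False)"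
        "link m ?S (flip x i = y) (c, flip b i, False) (c, flip b i, True)"
        "link m ?S (flip x i = y) (d, flip b i, False) (d, flip b i, True)"
        by (rule link_cross; use a(3) cube fb aS[OF i] in auto)+
    qed (use aF i cube M[OF i] facts a(3) in auto)
  next
    fix i j p assume ij: "i < m" "j < m" "i \<noteq> j" and p: "p \<in> W i" "p \<in> W j"
    have neq: "a i \<noteq> a j" "flip b i \<noteq> flip b j" "flip b i \<noteq> b" "flip b j \<noteq> b"
      using a(1) ij bl by (auto simp: inj_on_def flip_inj)
    \<comment> \<open>The class 1 part of a tree, sorted by column; when the contact column is
      \<open>c\<close> or \<open>d\<close>, its only extra vertex there is the one at
      \<open>b\<close>.\<close>
    have upper: "q = c \<and> (r \<in> H k \<or> r = b \<and> a k = c) \<or> q = d \<and> (r \<in> K k \<or> r = b \<and> a k = d) \<or>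
        q = a k \<and> q \<noteq> c \<and> q \<noteq> d" if "(q, r, True) \<in> W k" for q r k
      using that by (auto simp: W_def M_def split: if_splits)
    obtain q r t where p_eq: "p = (q, r, t)" by (cases p)
    show "p \<in> ?S"
    proof (cases t)
      case False
      then show ?thesis using p neq fanD(6)[OF F ij] by (auto simp: p_eq W_def)
    next
      case True
      \<comment> \<open>At most one tree has contact \<open>c\<close> and so gets the extra
        \<open>b\<close>; if another tree meets it there, \<open>b\<close> lies in that tree's fan
        and hence equals \<open>z\<close>.\<close>
      have "r = z" if "r \<in> H i \<or> r = b \<and> a i = c" "r \<in> H j \<or> r = b \<and> a j = c"
        using that neq(1) fanD(6)[OF H ij] fanD(5)[OF H ij(1)] fanD(5)[OF H ij(2)] by metis
      moreover have "r = w" if "r \<in> K i \<or> r = b \<and> a i = d" "r \<in> K j \<or> r = b \<and> a j = d"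
        using that neq(1) fanD(6)[OF K ij] fanD(5)[OF K ij(1)] fanD(5)[OF K ij(2)] by metis
      ultimately have "q = c \<and> r = z \<or> q = d \<and> r = w"
        using upper[of q r i] upper[of q r j] p True ne(2) neq(1) unfolding p_eq by metis
      then show ?thesis using True by (auto simp: p_eq)
    qed
  qed (use cube in auto)
qed

definition cluster_key :: "dvert \<Rightarrow> bool list \<times> bool" where
  "cluster_key = (\<lambda>(a, b, t). (if t then a else b, t))"

text \<open>With the shared cluster in class 0, the classes of \<open>r\<close> and \<open>s\<close>
  select one of the three constructions; if only \<open>r\<close> is in class 1, the roles of
  \<open>r\<close> and \<open>s\<close> are exchanged.\<close>

lemma packing_three_clusters:
  assumes m: "m \<ge> 3" and V: "p \<in> dverts m" "q \<in> dverts m" "r \<in> dverts m" "s \<in> dverts m"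
    and p: "\<not> snd (snd p)" and "p \<noteq> q" "cluster_key p = cluster_key q"
    and "cluster_key r \<noteq> cluster_key p" "cluster_key s \<noteq> cluster_key p" "cluster_key r \<noteq> cluster_key s"
  shows "packing m {p, q, r, s}"
proof -
  obtain x b y where pq: "p = (x, b, False)" "q = (y, b, False)" "x \<noteq> y"
    using p assms(7,8) by (cases p; cases q) (auto simp: cluster_key_def split: if_splits)
  obtain r1 r2 rt s1 s2 st where rs: "r = (r1, r2, rt)" "s = (s1, s2, st)"
    by (metis prod_cases3)
  have cube: "x \<in> cube m" "y \<in> cube m" "b \<in> cube m" "r1 \<in> cube m" "r2 \<in> cube m" "s1 \<in> cube m" "s2 \<in> cube m"
    using V by (auto simp: pq rs dverts_def)
  consider "\<not> rt" "\<not> st" | "\<not> rt" st | rt "\<not> st" | rt st by blast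
  then show ?thesis
  proof cases
    case 1
    then show ?thesis
      using packing_same_class[of x m y r1 s1 b r2 s2] cube assms(9-) pq(3)
      by (auto simp: pq(1,2) rs cluster_key_def)
  next
    case 2
    then show ?thesis
      using packing_one_opposite[of x m y r1 s2 b r2 s1] cube assms(9-) pq(3) m
      by (auto simp: pq(1,2) rs cluster_key_def)
  next
    case 3
    then have "packing m {p, q, s, r}"
      using packing_one_opposite[of x m y s1 r2 b s2 r1] cube assms(9-) pq(3) m
      by (auto simp: pq(1,2) rs cluster_key_def)
    then show ?thesis by (simp add: insert_commute)
  next
    case 4
    then show ?thesis
      using packing_two_opposite[of x m y r2 s2 b r1 s1] cube assms(9-) pq(3)
      by (auto simp: pq(1,2) rs cluster_key_def)
  qed
qed

section \<open>From packings to internally disjoint trees\<close>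

lemma finite_dverts: "finite (dverts m)"
proof -
  have "finite (cube m)"
    using finite_lists_length_eq[of "UNIV :: bool set" m] by (simp add: cube_def)
  moreover have "dverts m = cube m \<times> cube m \<times> UNIV" by (auto simp: dverts_def)
  ultimately show ?thesis by (metis finite_SigmaI finite)
qed

text \<open>Spanning trees are taken in the images of the linked pairs. Both ends of an edge common
  to two trees would lie in both vertex sets, hence in \<open>S\<close>; then \<open>link\<close>
  requires both flags to be set, which a packing forbids.\<close>

lemma trees_of_packing:
  assumes inj: "inj_on \<phi> (dverts m)" and vert: "\<And>p. p \<in> dverts m \<Longrightarrow> \<phi> p \<in> dc_vertices n"
    and adj: "\<And>p q. dadj m p q \<Longrightarrow> dc_adj n (\<phi> p) (\<phi> q)"
    and pack: "packing m S" and ne: "S \<noteq> {}"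
  shows "\<exists>T. (\<forall>i<m. dc_S_tree n (\<phi> ` S) (T i)) \<and> internally_disjoint (\<phi> ` S) m T"
proof -
  obtain W e where "\<forall>i<m. S \<subseteq> W i \<and> W i \<subseteq> dverts m \<and> conn (link m S (e i)) (W i)"
      "\<forall>i<m. \<forall>j<m. i \<noteq> j \<longrightarrow> W i \<inter> W j \<subseteq> S \<and> \<not> (e i \<and> e j)"
    using pack unfolding packing_def by (elim exE conjE)
  then have W: "\<And>i. i < m \<Longrightarrow> S \<subseteq> W i" "\<And>i. i < m \<Longrightarrow> W i \<subseteq> dverts m"
      "\<And>i. i < m \<Longrightarrow> conn (link m S (e i)) (W i)"
    and dis: "\<And>i j. i < m \<Longrightarrow> j < m \<Longrightarrow> i \<noteq> j \<Longrightarrow> W i \<inter> W j \<subseteq> S \<and> \<not> (e i \<and> e j)"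
    by simp_all
  define E where "E i = {{\<phi> p, \<phi> q} | p q. p \<in> W i \<and> q \<in> W i \<and> link m S (e i) p q}" for i
  have "\<exists>E'\<subseteq>E i. is_tree (\<phi> ` W i) E'" if i: "i < m" for i
  proof (rule spanning_tree_exists)
    have "E i \<subseteq> Pow (\<phi> ` W i)" by (auto simp: E_def)
    then show "finite (E i)"
      using W(2)[OF i] finite_dverts by (meson finite_Pow_iff finite_imageI finite_subset)
    show "\<phi> ` W i \<noteq> {}" using W(1)[OF i] ne by auto
    show "\<forall>e\<in>E i. e \<subseteq> \<phi> ` W i" by (auto simp: E_def)
    have "(\<phi> p, \<phi> q) \<in> (edge_rel (E i))\<^sup>*"
      if "(p, q) \<in> {(a, b). a \<in> W i \<and> b \<in> W i \<and> link m S (e i) a b}\<^sup>*" for p q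
      using that
    proof (induction rule: rtrancl_induct)
      case (step q r)
      then have qr: "q \<in> W i" "r \<in> W i" "link m S (e i) q r" by auto
      then have "q \<noteq> r" by (auto simp: link_def dadj_def split: if_splits)
      then have "\<phi> q \<noteq> \<phi> r" using qr inj W(2)[OF i] by (meson inj_onD subsetD)
      then have "(\<phi> q, \<phi> r) \<in> edge_rel (E i)" using qr unfolding edge_rel_def E_def by blast
      with step.IH show ?case by (rule rtrancl_into_rtrancl)
    qed simp
    then show "connected_graph (\<phi> ` W i) (E i)"
      using W(3)[OF i] by (auto simp: connected_graph_def conn_def)
  qed
  then obtain E' where E': "\<And>i. i < m \<Longrightarrow> E' i \<subseteq> E i" "\<And>i. i < m \<Longrightarrow> is_tree (\<phi> ` W i) (E' i)"
    by metis
  have meet: "\<phi> ` W i \<inter> \<phi> ` W j = \<phi> ` S" if "i < m" "j < m" "i \<noteq> j" for i j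
  proof -
    have "\<phi> ` W i \<inter> \<phi> ` W j = \<phi> ` (W i \<inter> W j)"
      using inj_on_image_Int[OF inj] W(2) that by metis
    also have "W i \<inter> W j = S" using dis[OF that] W(1) that by blast
    finally show ?thesis .
  qed
  have "E i \<inter> E j = {}" if ij: "i < m" "j < m" "i \<noteq> j" for i j
  proof (rule ccontr)
    assume "E i \<inter> E j \<noteq> {}"
    then obtain p q p' q' where pq: "p \<in> W i" "q \<in> W i" "link m S (e i) p q"
        and pq': "p' \<in> W j" "q' \<in> W j" "link m S (e j) p' q'" and eq: "{\<phi> p, \<phi> q} = {\<phi> p', \<phi> q'}"
      unfolding E_def by blast
    have "\<phi> ` {p, q} = \<phi> ` {p', q'}" using eq by simp
    then have "{p, q} = {p', q'}"
      using inj_on_image_eq_iff[OF inj, of "{p, q}" "{p', q'}"] pq pq' W(2) ij by blast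
    then have "p \<in> S" "q \<in> S" "p' \<in> S" "q' \<in> S" using pq pq' dis[OF ij] by (auto simp: doubleton_eq_iff)
    then show False using pq(3) pq'(3) dis[OF ij] by (auto simp: link_def)
  qed
  then have "E' i \<inter> E' j = {}" if "i < m" "j < m" "i \<noteq> j" for i j
    using E'(1)[OF that(1)] E'(1)[OF that(2)] that by blast
  then have "internally_disjoint (\<phi> ` S) m (\<lambda>i. (\<phi> ` W i, E' i))"
    using meet by (simp add: internally_disjoint_def)
  moreover have "dc_S_tree n (\<phi> ` S) (\<phi> ` W i, E' i)" if "i < m" for i
  proof -
    have "E i \<subseteq> dc_edges n"
    proof
      fix f assume "f \<in> E i"
      then obtain p q where "f = {\<phi> p, \<phi> q}" "dadj m p q" unfolding E_def link_def by blast
      then show "f \<in> dc_edges n" using adj unfolding dc_edges_def by blast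
    qed
    moreover have "\<phi> ` W i \<subseteq> dc_vertices n" using W(2)[OF that] vert by blast
    ultimately show ?thesis
      using E'[OF that] W(1)[OF that] by (simp add: dc_S_tree_def dc_subtree_def image_mono order_trans)
  qed
  ultimately show ?thesis by (intro exI[of _ "\<lambda>i. (\<phi> ` W i, E' i)"]) simp
qed

section \<open>Clusters as equivalence classes\<close>

definition same_cluster :: "nat \<Rightarrow> vertex \<Rightarrow> vertex \<Rightarrow> bool" where
  "same_cluster n u v \<longleftrightarrow> bit u (2*n-1) = bit v (2*n-1) \<and>
     (\<forall>i \<in> (if bit u (2*n-1) then {1..n-1} else {n..2*n-2}). bit u i = bit v i)"

definition cluster_of :: "nat \<Rightarrow> vertex \<Rightarrow> vertex set" where
  "cluster_of n u = {v \<in> dc_vertices n. same_cluster n u v}"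

lemma cluster_of_eq_iff:
  assumes "u \<in> dc_vertices n" "v \<in> dc_vertices n"
  shows "cluster_of n u = cluster_of n v \<longleftrightarrow> same_cluster n u v"
proof
  assume "cluster_of n u = cluster_of n v"
  moreover have "v \<in> cluster_of n v" using assms by (simp add: cluster_of_def same_cluster_def)
  ultimately show "same_cluster n u v" by (auto simp: cluster_of_def)
next
  assume "same_cluster n u v"
  then show "cluster_of n u = cluster_of n v"
    unfolding cluster_of_def same_cluster_def by (intro Collect_cong) auto
qed

lemma dc_clusters_eq: "dc_clusters n = cluster_of n ` dc_vertices n"
proof -
  have "cluster_of n u0 = {u \<in> dc_vertices n. \<not> bit u (2*n-1) \<and> (\<forall>i\<in>{n..2*n-2}. bit u i = bit u0 i)}"
    if "\<not> bit u0 (2*n-1)" for u0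
    using that unfolding cluster_of_def same_cluster_def by (intro Collect_cong) auto
  moreover have "cluster_of n u0 = {u \<in> dc_vertices n. bit u (2*n-1) \<and> (\<forall>i\<in>{1..n-1}. bit u i = bit u0 i)}"
    if "bit u0 (2*n-1)" for u0
    using that unfolding cluster_of_def same_cluster_def by (intro Collect_cong) auto
  ultimately have "{{u \<in> dc_vertices n. \<not> bit u (2*n-1) \<and> (\<forall>i\<in>{n..2*n-2}. bit u i = bit u0 i)}
        | u0. u0 \<in> dc_vertices n \<and> \<not> bit u0 (2*n-1)} = cluster_of n ` {u \<in> dc_vertices n. \<not> bit u (2*n-1)}"
      "{{u \<in> dc_vertices n. bit u (2*n-1) \<and> (\<forall>i\<in>{1..n-1}. bit u i = bit u0 i)}
        | u0. u0 \<in> dc_vertices n \<and> bit u0 (2*n-1)} = cluster_of n ` {u \<in> dc_vertices n. bit u (2*n-1)}"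
    unfolding setcompr_eq_image by (simp_all cong: image_cong_simp)
  then show ?thesis unfolding dc_clusters_def by (auto simp flip: image_Un)
qed

text \<open>Each vertex lies in exactly one cluster, its own. This turns the number of clusters met
  by \<open>S\<close> into the size of an image of \<open>S\<close>.\<close>

lemma clusters_meeting:
  assumes "S \<subseteq> dc_vertices n"
  shows "{C \<in> dc_clusters n. C \<inter> S \<noteq> {}} = cluster_of n ` S"
proof (intro equalityI subsetI)
  fix C assume "C \<in> {C \<in> dc_clusters n. C \<inter> S \<noteq> {}}"
  then obtain v where "C \<in> dc_clusters n" "v \<in> C" "v \<in> S" by blast
  then obtain u where "u \<in> dc_vertices n" "C = cluster_of n u" "same_cluster n u v"
    unfolding dc_clusters_eq by (auto simp: cluster_of_def)
  then have "C = cluster_of n v" using cluster_of_eq_iff assms \<open>v \<in> S\<close> by blast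
  then show "C \<in> cluster_of n ` S" using \<open>v \<in> S\<close> by simp
next
  fix C assume "C \<in> cluster_of n ` S"
  then obtain v where v: "v \<in> S" "C = cluster_of n v" by blast
  moreover have "v \<in> cluster_of n v" using v assms by (auto simp: cluster_of_def same_cluster_def)
  ultimately show "C \<in> {C \<in> dc_clusters n. C \<inter> S \<noteq> {}}"
    using assms by (auto simp: dc_clusters_eq)
qed

text \<open>Four points with three values: some pair shares a value, and the count then forces the
  other two values to be new and distinct.\<close>

lemma card_image_3_cases:
  assumes "distinct [x, y, z, w]" "card (f ` {x, y, z, w}) = 3"
  obtains p q r s where "{p, q, r, s} = {x, y, z, w}" "p \<noteq> q" "f p = f q" "f r \<noteq> f p" "f s \<noteq> f p" "f r \<noteq> f s"
proof -
  have card: "card {f x, f y, f z, f w} = 3" using assms by simp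
  have "\<not> distinct [f x, f y, f z, f w]" using card distinct_card[of "[f x, f y, f z, f w]"] by auto
  then consider "f x = f y" | "f x = f z" | "f x = f w" | "f y = f z" | "f y = f w" | "f z = f w" by auto
  then show thesis
  proof cases
    case 1
    show thesis by (rule that[of x y z w]) (use 1 assms card in \<open>auto simp: card_insert_if split: if_splits\<close>)
  next
    case 2
    show thesis by (rule that[of x z y w]) (use 2 assms card in \<open>auto simp: card_insert_if split: if_splits\<close>)
  next
    case 3
    show thesis by (rule that[of x w y z]) (use 3 assms card in \<open>auto simp: card_insert_if split: if_splits\<close>)
  next
    case 4
    show thesis by (rule that[of y z x w]) (use 4 assms card in \<open>auto simp: card_insert_if split: if_splits\<close>)
  next
    case 5
    show thesis by (rule that[of y w x z]) (use 5 assms card in \<open>auto simp: card_insert_if split: if_splits\<close>)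
  next
    case 6
    show thesis by (rule that[of z w x y]) (use 6 assms card in \<open>auto simp: card_insert_if split: if_splits\<close>)
  qed
qed

section \<open>Binary strings as triples, and the transfer to \<open>D_n\<close>\<close>

lemma flip_append:
  "i < length a \<Longrightarrow> flip (a @ c) i = flip a i @ c"
  "flip (a @ c) (length a + i) = a @ flip c i"
  by (auto simp: flip_def list_update_append nth_append)

text \<open>List indices start at 0 and bit positions at 1, so the flip at \<open>k\<close> changes
  position \<open>Suc k\<close>, and the last bit is \<open>u ! (2 * n - 2)\<close>. A flip subject
  to a condition on the last bit leaves that bit unchanged, so the condition passes to the other
  end.\<close>

lemma dc_adj_flipI:
  assumes "length u = 2 * n - 1" "k < 2 * n - 1"
    and "k < n - 1 \<Longrightarrow> \<not> u ! (2 * n - 2)" "n - 1 \<le> k \<Longrightarrow> k < 2 * n - 2 \<Longrightarrow> u ! (2 * n - 2)"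
  shows "dc_adj n u (flip u k)"
  unfolding dc_adj_def
proof (intro conjI bexI[where x = "Suc k"])
  show "u \<in> dc_vertices n" "flip u k \<in> dc_vertices n" using assms by (auto simp: dc_vertices_def)
  show "Suc k \<in> {1..2*n-1}" using assms by auto
  show "bit u (Suc k) \<noteq> bit (flip u k) (Suc k)" using assms by (simp add: bit_def nth_flip)
  show "\<forall>j\<in>{1..2*n-1}. j \<noteq> Suc k \<longrightarrow> bit u j = bit (flip u k) j"
    using assms by (auto simp: bit_def nth_flip)
  have last: "bit (flip u k) (2*n-1) = (if k = 2*n-2 then \<not> u ! (2*n-2) else u ! (2*n-2))"
    using assms(1,2) by (auto simp: bit_def nth_flip numeral_2_eq_2)
  have last': "bit u (2*n-1) = u ! (2*n-2)" by (simp add: bit_def numeral_2_eq_2)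
  show "1 \<le> Suc k \<and> Suc k \<le> n - 1 \<longrightarrow> \<not> bit u (2*n-1) \<and> \<not> bit (flip u k) (2*n-1)"
    unfolding last last' using assms by auto
  show "n \<le> Suc k \<and> Suc k \<le> 2*n-2 \<longrightarrow> bit u (2*n-1) \<and> bit (flip u k) (2*n-1)"
    unfolding last last' using assms by auto
qed

lemma dc_adj_append:
  assumes "length a = m" "length b = m"
  shows "i < m \<Longrightarrow> dc_adj (Suc m) (a @ b @ [False]) (flip a i @ b @ [False])"
    and "i < m \<Longrightarrow> dc_adj (Suc m) (a @ b @ [True]) (a @ flip b i @ [True])"
    and "dc_adj (Suc m) (a @ b @ [t]) (a @ b @ [\<not> t])"
proof -
  show "dc_adj (Suc m) (a @ b @ [False]) (flip a i @ b @ [False])" if "i < m"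
    using dc_adj_flipI[of "a @ b @ [False]" "Suc m" i] that assms
    by (simp add: flip_append nth_append)
  show "dc_adj (Suc m) (a @ b @ [True]) (a @ flip b i @ [True])" if "i < m"
    using dc_adj_flipI[of "a @ b @ [True]" "Suc m" "m + i"] that assms
      flip_append(2)[of a "b @ [True]" i]
    by (simp add: flip_append(1) nth_append)
  show "dc_adj (Suc m) (a @ b @ [t]) (a @ b @ [\<not> t])"
    using dc_adj_flipI[of "a @ b @ [t]" "Suc m" "m + m"] assms
      flip_append(2)[of a "b @ [t]" m] flip_append(2)[of b "[t]" 0]
    by (simp add: nth_append)
qed

text \<open>The second form reflects the automorphism of the dual cube that exchanges the two halves
  of a string and complements the last bit.\<close>

lemma dc_adj_of_dadj:
  assumes "dadj m (a, b, s) (a', b', t)"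
  shows "dc_adj (Suc m) (a @ b @ [s]) (a' @ b' @ [t])"
    and "dc_adj (Suc m) (b @ a @ [\<not> s]) (b' @ a' @ [\<not> t])"
proof -
  have len: "length a = m" "length b = m" using assms by (auto simp: dadj_def cube_def)
  consider (row) i where "s = False" "t = False" "b' = b" "a' = flip a i" "i < m"
    | (col) i where "s = True" "t = True" "a' = a" "b' = flip b i" "i < m"
    | (cross) "t = (\<not> s)" "a' = a" "b' = b"
    using assms by (auto simp: dadj_def qadj_def cube_def split: if_splits)
  then have "dc_adj (Suc m) (a @ b @ [s]) (a' @ b' @ [t]) \<and>
      dc_adj (Suc m) (b @ a @ [\<not> s]) (b' @ a' @ [\<not> t])"
  proof cases
    case row
    then show ?thesis
      using dc_adj_append(1)[OF len, of i] dc_adj_append(2)[OF len(2,1), of i] by simp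
  next
    case col
    then show ?thesis
      using dc_adj_append(2)[OF len, of i] dc_adj_append(1)[OF len(2,1), of i] by simp
  next
    case cross
    then show ?thesis
      using dc_adj_append(3)[OF len, of s] dc_adj_append(3)[OF len(2,1), of "\<not> s"] by simp
  qed
  then show "dc_adj (Suc m) (a @ b @ [s]) (a' @ b' @ [t])"
    "dc_adj (Suc m) (b @ a @ [\<not> s]) (b' @ a' @ [\<not> t])" by blast+
qed

lemma same_cluster_append:
  assumes "length a = m" "length b = m" "length a' = m" "length b' = m"
  shows "same_cluster (Suc m) (a @ b @ [s]) (a' @ b' @ [t]) \<longleftrightarrow> s = t \<and> (if s then a = a' else b = b')"
proof -
  have last: "bit (a @ b @ [s]) (2 * Suc m - 1) = s" "bit (a' @ b' @ [t]) (2 * Suc m - 1) = t"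
    using assms by (simp_all add: bit_def nth_append)
  have "(\<forall>i\<in>{1..Suc m - 1}. bit (a @ b @ [s]) i = bit (a' @ b' @ [t]) i) \<longleftrightarrow> (\<forall>i<m. a ! i = a' ! i)"
  proof -
    have "{1..Suc m - 1} = Suc ` {..<m}" by (auto simp: image_iff) (metis Suc_le_D Suc_le_lessD lessThan_iff)
    then show ?thesis using assms by (auto simp: bit_def nth_append)
  qed
  moreover have "(\<forall>i\<in>{Suc m..2 * Suc m - 2}. bit (a @ b @ [s]) i = bit (a' @ b' @ [t]) i) \<longleftrightarrow>
      (\<forall>i<m. b ! i = b' ! i)"
  proof -
    have "{Suc m..2 * Suc m - 2} = (\<lambda>i. Suc (m + i)) ` {..<m}"
    proof (intro equalityI subsetI)
      fix k assume "k \<in> {Suc m..2 * Suc m - 2}"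
      then have "k = Suc (m + (k - Suc m))" "k - Suc m < m" by auto
      then show "k \<in> (\<lambda>i. Suc (m + i)) ` {..<m}" by blast
    qed auto
    then show ?thesis using assms by (auto simp: bit_def nth_append)
  qed
  moreover have "(\<forall>i<m. a ! i = a' ! i) \<longleftrightarrow> a = a'" "(\<forall>i<m. b ! i = b' ! i) \<longleftrightarrow> b = b'"
    using assms by (auto simp: list_eq_iff_nth_eq)
  ultimately show ?thesis unfolding same_cluster_def last by (cases s) simp_all
qed

lemma same_cluster_iff_key:
  assumes "(a, b, s) \<in> dverts m" "(a', b', t) \<in> dverts m"
  shows "same_cluster (Suc m) (a @ b @ [s]) (a' @ b' @ [t]) \<longleftrightarrow>
      cluster_key (a, b, s) = cluster_key (a', b', t)"
    and "same_cluster (Suc m) (b @ a @ [\<not> s]) (b' @ a' @ [\<not> t]) \<longleftrightarrow>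
      cluster_key (a, b, s) = cluster_key (a', b', t)"
proof -
  have len: "length a = m" "length b = m" "length a' = m" "length b' = m"
    using assms by (auto simp: dverts_def cube_def)
  show "same_cluster (Suc m) (a @ b @ [s]) (a' @ b' @ [t]) \<longleftrightarrow>
      cluster_key (a, b, s) = cluster_key (a', b', t)"
    unfolding same_cluster_append[OF len] by (auto simp: cluster_key_def)
  show "same_cluster (Suc m) (b @ a @ [\<not> s]) (b' @ a' @ [\<not> t]) \<longleftrightarrow>
      cluster_key (a, b, s) = cluster_key (a', b', t)"
    unfolding same_cluster_append[OF len(2,1,4,3)] by (auto simp: cluster_key_def)
qed

lemma dc_vertex_cases:
  assumes "u \<in> dc_vertices (Suc m)"
  obtains a b t where "length a = m" "length b = m" "u = a @ b @ [t]"
proof -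
  have len: "length u = m + m + 1" using assms by (simp add: dc_vertices_def)
  show thesis
  proof (rule that)
    have "u = take m u @ drop m u" by simp
    also have "drop m u = take m (drop m u) @ drop m (drop m u)" by (simp only: append_take_drop_id)
    also have "drop m (drop m u) = [u ! (m + m)]"
      using len by (intro nth_equalityI) auto
    finally show "u = take m u @ take m (drop m u) @ [u ! (m + m)]" .
  qed (use len in auto)
qed

text \<open>Stated for an arbitrary isomorphic labelling so that it serves both class orientations;
  the assumption on \<open>p\<close> says that the shared cluster is a row in the labelling.\<close>

lemma trees_of_embedding:
  assumes inj: "inj_on \<phi> (dverts m)" and surj: "\<phi> ` dverts m = dc_vertices (Suc m)"
    and adj: "\<And>p q. dadj m p q \<Longrightarrow> dc_adj (Suc m) (\<phi> p) (\<phi> q)"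
    and key: "\<And>p q. p \<in> dverts m \<Longrightarrow> q \<in> dverts m \<Longrightarrow>
      same_cluster (Suc m) (\<phi> p) (\<phi> q) \<longleftrightarrow> cluster_key p = cluster_key q"
    and m: "m \<ge> 3" and S: "{p, q, r, s} \<subseteq> dc_vertices (Suc m)"
    and p: "\<And>p'. p' \<in> dverts m \<Longrightarrow> \<phi> p' = p \<Longrightarrow> \<not> snd (snd p')"
    and ne: "p \<noteq> q" and same: "same_cluster (Suc m) p q"
      "\<not> same_cluster (Suc m) r p" "\<not> same_cluster (Suc m) s p" "\<not> same_cluster (Suc m) r s"
  shows "\<exists>T. (\<forall>i<m. dc_S_tree (Suc m) {p, q, r, s} (T i)) \<and> internally_disjoint {p, q, r, s} m T"
proof -
  obtain p' q' r' s' where pre: "p' \<in> dverts m" "q' \<in> dverts m" "r' \<in> dverts m" "s' \<in> dverts m"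
    and eqs: "\<phi> p' = p" "\<phi> q' = q" "\<phi> r' = r" "\<phi> s' = s"
    using S unfolding surj[symmetric] by auto
  have "packing m {p', q', r', s'}"
    by (rule packing_three_clusters[OF m pre p[OF pre(1) eqs(1)]])
       (use same ne key[OF pre(1,2)] key[OF pre(3,1)] key[OF pre(4,1)] key[OF pre(3,4)] eqs in auto)
  then have "\<exists>T. (\<forall>i<m. dc_S_tree (Suc m) (\<phi> ` {p', q', r', s'}) (T i)) \<and>
      internally_disjoint (\<phi> ` {p', q', r', s'}) m T"
    by (intro trees_of_packing inj adj) (use surj in auto)
  then show ?thesis by (simp add: eqs)
qed

theorem mainTheorem4:
  fixes n :: nat and x y z w :: vertex
  assumes "n \<ge> 4"
    and "x \<in> dc_vertices n" "y \<in> dc_vertices n" "z \<in> dc_vertices n" "w \<in> dc_vertices n"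
    and "distinct [x, y, z, w]"
    and "card {C \<in> dc_clusters n. C \<inter> {x, y, z, w} \<noteq> {}} = 3"
  shows "\<exists>T. (\<forall>i < n - 1. dc_S_tree n {x, y, z, w} (T i)) \<and>
             internally_disjoint {x, y, z, w} (n - 1) T"
proof -
  obtain m where n: "n = Suc m" using assms(1) by (cases n) auto
  have m: "m \<ge> 3" using assms(1) n by simp
  have "card (cluster_of n ` {x, y, z, w}) = 3"
    using assms(2-5,7) clusters_meeting[of "{x, y, z, w}" n] by simp
  then obtain p q r s where S: "{p, q, r, s} = {x, y, z, w}" and pq: "p \<noteq> q"
      and cl: "cluster_of n p = cluster_of n q" "cluster_of n r \<noteq> cluster_of n p"
        "cluster_of n s \<noteq> cluster_of n p" "cluster_of n r \<noteq> cluster_of n s"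
    by (rule card_image_3_cases[OF assms(6)])
  have sub: "{p, q, r, s} \<subseteq> dc_vertices (Suc m)" using assms(2-5) S n by auto
  have same: "same_cluster (Suc m) p q" "\<not> same_cluster (Suc m) r p" "\<not> same_cluster (Suc m) s p"
      "\<not> same_cluster (Suc m) r s"
    using cl sub cluster_of_eq_iff unfolding n by (metis insert_subset)+
  obtain a b t where abt: "length a = m" "length b = m" "p = a @ b @ [t]"
    using dc_vertex_cases[of p m] sub by auto
  have "\<exists>T. (\<forall>i<m. dc_S_tree (Suc m) {p, q, r, s} (T i)) \<and> internally_disjoint {p, q, r, s} m T"
  \<comment> \<open>The last bit of \<open>p\<close> is the class of the shared cluster and decides
    which labelling turns that cluster into a row.\<close>
  proof (cases t)
    case False
    define \<phi> :: "dvert \<Rightarrow> vertex" where "\<phi> = (\<lambda>(a, b, t). a @ b @ [t])"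
    show ?thesis
    proof (rule trees_of_embedding[OF _ _ _ _ m sub _ pq same])
      show "inj_on \<phi> (dverts m)" by (auto simp: \<phi>_def inj_on_def dverts_def cube_def)
      show "\<phi> ` dverts m = dc_vertices (Suc m)"
      proof (intro equalityI subsetI)
        fix u assume "u \<in> dc_vertices (Suc m)"
        then obtain a b t where "length a = m" "length b = m" "u = a @ b @ [t]"
          by (rule dc_vertex_cases)
        then show "u \<in> \<phi> ` dverts m"
          by (intro image_eqI[of _ _ "(a, b, t)"]) (auto simp: \<phi>_def dverts_def cube_def)
      qed (auto simp: \<phi>_def dverts_def cube_def dc_vertices_def)
      show "dc_adj (Suc m) (\<phi> p) (\<phi> q)" if "dadj m p q" for p q
        using that by (cases p; cases q) (simp add: \<phi>_def dc_adj_of_dadj)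
      show "same_cluster (Suc m) (\<phi> p) (\<phi> q) \<longleftrightarrow> cluster_key p = cluster_key q"
        if "p \<in> dverts m" "q \<in> dverts m" for p q
        using that by (cases p; cases q) (simp add: \<phi>_def same_cluster_iff_key)
      show "\<not> snd (snd p')" if "p' \<in> dverts m" "\<phi> p' = p" for p'
        using that abt False by (auto simp: \<phi>_def dverts_def cube_def)
    qed
  next
    case True
    \<comment> \<open>This embedding swaps the two classes, so that \<open>p\<close> and \<open>q\<close> again come from class 0.\<close>
    define \<phi> :: "dvert \<Rightarrow> vertex" where "\<phi> = (\<lambda>(a, b, t). b @ a @ [\<not> t])"
    show ?thesis
    proof (rule trees_of_embedding[OF _ _ _ _ m sub _ pq same])
      show "inj_on \<phi> (dverts m)" by (auto simp: \<phi>_def inj_on_def dverts_def cube_def)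
      show "\<phi> ` dverts m = dc_vertices (Suc m)"
      proof (intro equalityI subsetI)
        fix u assume "u \<in> dc_vertices (Suc m)"
        then obtain a b t where "length a = m" "length b = m" "u = a @ b @ [t]"
          by (rule dc_vertex_cases)
        then show "u \<in> \<phi> ` dverts m"
          by (intro image_eqI[of _ _ "(b, a, \<not> t)"]) (auto simp: \<phi>_def dverts_def cube_def)
      qed (auto simp: \<phi>_def dverts_def cube_def dc_vertices_def)
      show "dc_adj (Suc m) (\<phi> p) (\<phi> q)" if "dadj m p q" for p q
        using that by (cases p; cases q) (simp add: \<phi>_def dc_adj_of_dadj)
      show "same_cluster (Suc m) (\<phi> p) (\<phi> q) \<longleftrightarrow> cluster_key p = cluster_key q"
        if "p \<in> dverts m" "q \<in> dverts m" for p q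
        using that by (cases p; cases q) (simp add: \<phi>_def same_cluster_iff_key)
      show "\<not> snd (snd p')" if "p' \<in> dverts m" "\<phi> p' = p" for p'
        using that abt True by (auto simp: \<phi>_def dverts_def cube_def)
    qed
  qed
  then show ?thesis unfolding S n by simp
qed

end
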